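(* Let $\alpha\in(0,\infty)\setminus\mathbb{N}$, $n=[\alpha]+1$ and $T>0$. If $x:(0,\infty)\to\mathbb{R}$ is a non-constant $T$-periodic function of class $C^n$ on $(0,\infty)$, then its Riemann-Liouville derivative ${}^{RL}D^{\alpha}x$ and its Grunwald-Letnikov derivative ${}^{GL}D^{\alpha}x$ cannot be $T$-periodic functions (that is, neither of them is $T$-periodic).
   Context: $[\cdot]$ denotes the integer part. A function $x$ on $(0,\infty)$ is $T$-periodic if $x(t+T)=x(t)$ for all $t\in(0,\infty)$. A $T$-periodic function of class $C^n$ on $(0,\infty)$ extends to a function of class $C^n$ on $[0,\infty)$ by setting $x(0)=x(0^+)=x(T)$. For $\alpha\in(0,\infty)\setminus\mathbb{N}$, $n=[\alpha]+1$ and $g$ of class $C^n$, the fractional-order derivatives of order $\alpha$ with lower limit $0$ are, for $t>0$: Riemann-Liouville: $${}^{RL}D^{\alpha}g(t)=\frac{1}{\Gamma(n-\alpha)}\left(\frac{d}{dt}\right)^n\int_0^t (t-s)^{n-\alpha-1}g(s)\,ds;$$ Grunwald-Letnikov: $${}^{GL}D^{\alpha}g(t)=\lim_{h\to 0}h^{-\alpha}\sum_{r=0}^{[t/h]}(-1)^r\binom{\alpha}{r}g(t-rh),$$ where the limit is taken over $h>0$ and $\binom{\alpha}{r}=\frac{\alpha(\alpha-1)\cdots(\alpha-r+1)}{r!}$. *)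

theory Defs
  imports "HOL-Analysis.Analysis"
begin

text \<open>Functions on \<open>(0,\<infinity>)\<close> or \<open>[0,\<infinity>)\<close> are total functions on \<open>real\<close>; every notion
  below only uses their values on the relevant half-line.\<close>

definition periodic_on_pos :: "real \<Rightarrow> (real \<Rightarrow> real) \<Rightarrow> bool" where
  "periodic_on_pos T f \<longleftrightarrow> (\<forall>t>0. f (t + T) = f t)"

text \<open>Intended for open \<open>S\<close>, where the iterates of \<^const>\<open>deriv\<close> on \<open>S\<close> depend only on
  the values of \<open>f\<close> on \<open>S\<close>.\<close>

definition class_C_on :: "nat \<Rightarrow> real set \<Rightarrow> (real \<Rightarrow> real) \<Rightarrow> bool" where
  "class_C_on n S f \<longleftrightarrow>
     (\<forall>k<n. \<forall>t\<in>S. (deriv ^^ k) f differentiable (at t)) \<and> continuous_on S ((deriv ^^ n) f)"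

text \<open>The extension of a continuous \<open>T\<close>-periodic function from \<open>(0,\<infinity>)\<close> to \<open>[0,\<infinity>)\<close> by
  \<open>x(0) = x(0+) = x(T)\<close>.\<close>

definition extend_at_0 :: "real \<Rightarrow> (real \<Rightarrow> real) \<Rightarrow> real \<Rightarrow> real" where
  "extend_at_0 T x = x(0 := x T)"

definition RL_deriv :: "real \<Rightarrow> (real \<Rightarrow> real) \<Rightarrow> real \<Rightarrow> real" where
  "RL_deriv \<alpha> g t =
     (let n = nat \<lfloor>\<alpha>\<rfloor> + 1 in
       1 / Gamma (real n - \<alpha>) *
       (deriv ^^ n) (\<lambda>u. integral {0..u} (\<lambda>s. (u - s) powr (real n - \<alpha> - 1) * g s)) t)"

definition GL_deriv :: "real \<Rightarrow> (real \<Rightarrow> real) \<Rightarrow> real \<Rightarrow> real" where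
  "GL_deriv \<alpha> g t =
     Lim (at_right 0)
       (\<lambda>h. h powr (- \<alpha>) * (\<Sum>r = 0..nat \<lfloor>t / h\<rfloor>. (- 1) ^ r * (\<alpha> gchoose r) * g (t - real r * h)))"

end

theory Submission
  imports Defs
begin

text \<open>Extend \<open>x\<close> to a \<open>T\<close>-periodic function \<open>p\<close> of class \<open>C\<^sup>n\<close> on the whole line. For both derivatives the
  increment over one period involves only values of the kernel away from its singularity: it is
  a non-zero multiple of \<open>K t = \<integral>\<^sub>0\<^sup>T (t + u) powr (- \<alpha> - 1) * p (- u) du\<close>. If it vanishes for all
  \<open>t > 0\<close>, then so do all derivatives of \<open>K\<close> at \<open>1\<close>, so \<open>u \<mapsto> p (- u)\<close> is orthogonal, for the weight
  \<open>(1 + u) powr (- \<alpha> - 1)\<close>, to every polynomial in \<open>1 / (1 + u)\<close>; by Stone--Weierstrass \<open>p = 0\<close>.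

  Since \<^const>\<open>deriv\<close> and \<^const>\<open>Lim\<close> take junk values where no derivative or limit exists, one also
  needs that the fractional integral is \<open>n\<close> times differentiable and that the
  Grunwald-Letnikov limit exists. The former is seen after a substitution
  that removes the singularity of the kernel, the latter by \<open>n\<close> summations by parts, which
  reduce the weights to those of order \<open>\<alpha> - n \<in> (-1, 0)\<close>.\<close>

subsection \<open>Moments against shifted powers\<close>

text \<open>For \<open>c = - \<alpha> - 1\<close> and \<open>h u = p (- u)\<close> this is the
  \<open>K\<close> of the overview. The Riemann-Liouville argument meets it first with
  \<open>c = \<beta> - 1\<close>, before differentiating.\<close>

definition power_moment :: "real \<Rightarrow> (real \<Rightarrow> real) \<Rightarrow> real \<Rightarrow> real \<Rightarrow> real" where
  "power_moment T h c t = integral {0..T} (\<lambda>u. (t + u) powr c * h u)"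

text \<open>Differentiation under the integral sign: for \<open>t > 0\<close> the base
  \<open>t + u\<close> stays positive on \<open>{0..T}\<close>, so the kernel is smooth in
  \<open>t\<close> whatever the exponent.\<close>

lemma DERIV_power_moment:
  assumes h: "continuous_on {0..T} h" and t: "t > 0"
  shows "(power_moment T h c has_real_derivative c * power_moment T h (c - 1) t) (at t)"
proof -
  have "((\<lambda>t. integral (cbox 0 T) (\<lambda>u. (t + u) powr c * h u)) has_field_derivative
      integral (cbox 0 T) (\<lambda>u. c * ((t + u) powr (c - 1) * h u))) (at t within {0<..})"
  proof (rule leibniz_rule_field_derivative)
    show "((\<lambda>t. (t + u) powr c * h u) has_field_derivative c * ((s + u) powr (c - 1) * h u))
      (at s within {0<..})" if "s \<in> {0<..}" "u \<in> cbox 0 T" for s u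
      using that by (auto intro!: derivative_eq_intros simp: powr_diff field_simps)
    show "(\<lambda>u. (s + u) powr c * h u) integrable_on cbox 0 T" if "s \<in> {0<..}" for s
      using that h by (auto intro!: integrable_continuous_real continuous_intros)
    have "continuous_on ({0<..} \<times> {0..T}) (\<lambda>x. h (snd x))"
      using h by (auto intro: continuous_on_compose2[OF _ continuous_on_snd[OF continuous_on_id]])
    then show "continuous_on ({0<..} \<times> cbox 0 T) (\<lambda>(s, u). c * ((s + u) powr (c - 1) * h u))"
      by (auto simp: case_prod_unfold intro!: continuous_intros)
  qed (use t in \<open>auto simp: convex_real_interval\<close>)
  moreover have "at t within {0<..} = at t"
    using t by (simp add: at_within_open[of _ "{0<..}"])
  ultimately show ?thesis
    by (simp add: power_moment_def[abs_def])
qed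

lemma power_moment_vanishing:
  assumes h: "continuous_on {0..T} h" and T: "T > 0" and c: "c < 0"
    and zero: "\<And>t. t > 0 \<Longrightarrow> power_moment T h c t = 0" and u: "u \<in> {0..T}"
  shows "h u = 0"
proof -
  have all_zero: "power_moment T h (c - real k) t = 0" if "t > 0" for k t
    using that
  proof (induction k arbitrary: t)
    case (Suc k)
    have "(power_moment T h (c - real k) has_real_derivative 0) (at t)"
    proof (rule has_field_derivative_transform_within_open[of "\<lambda>_. 0" _ _ "{0<..}"])
    qed (use Suc in auto)
    \<comment> \<open>Comparing the two derivatives leaves the factor \<open>c - real k\<close>,
      which is non-zero because \<open>c < 0\<close>.\<close>
    from DERIV_unique[OF DERIV_power_moment[OF h \<open>t > 0\<close>] this] c
    show ?case by (simp add: algebra_simps)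
  qed (use zero in simp)
  define w where "w u = (1 + u) powr c" for u :: real
  have w_pos: "w u > 0" if "u \<in> {0..T}" for u
    using that by (simp add: w_def)
  have w_cont [continuous_intros]: "continuous_on {0..T} w"
    unfolding w_def by (intro continuous_intros) auto
  note [continuous_intros] = h
  have power_zero: "integral {0..T} (\<lambda>u. w u * h u * (1 / (1 + u)) ^ i) = 0" for i
  proof -
    have "integral {0..T} (\<lambda>u. w u * h u * (1 / (1 + u)) ^ i) = power_moment T h (c - real i) 1"
      unfolding power_moment_def
      by (rule integral_cong) (simp add: w_def powr_diff powr_realpow power_divide)
    then show ?thesis using all_zero[of 1 i] by simp
  qed
  have cont_pow: "continuous_on {0..T} (\<lambda>u. (1 / (1 + u)) ^ i)" for i :: nat
    by (intro continuous_intros) auto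
  define B where "B = integral {0..T} (\<lambda>u. w u * \<bar>h u\<bar>)"
  have square_le: "integral {0..T} (\<lambda>u. w u * (h u)\<^sup>2) \<le> e * B" if e: "e > 0" for e
  proof -
    \<comment> \<open>The variable \<open>v = 1 / (1 + u)\<close> turns \<open>{0..T}\<close> into
      the compact interval \<open>{1 / (1 + T)..1}\<close>, with \<open>u = 1 / v - 1\<close>. There
      \<open>h (1 / v - 1)\<close> is approximated by polynomials in \<open>v\<close>.\<close>
    have img: "1 / v - 1 \<in> {0..T}" if "v \<in> {1 / (1 + T)..1}" for v
    proof -
      from that T have "v > 0"
        by (smt (verit, best) atLeastAtMost_iff divide_pos_pos)
      with that T show ?thesis by (auto simp: field_simps)
    qed
    have ne: "v \<noteq> 0" if "v \<in> {1 / (1 + T)..1}" for v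
      using that T by (smt (verit, best) atLeastAtMost_iff divide_pos_pos)
    have "continuous_on {1 / (1 + T)..1} (\<lambda>v. h (1 / v - 1))"
      using img ne by (intro continuous_on_compose2[OF h] continuous_intros) auto
    from Stone_Weierstrass_real_polynomial_function[OF compact_Icc this e]
    obtain g where g: "real_polynomial_function g"
      and ge: "\<And>v. v \<in> {1 / (1 + T)..1} \<Longrightarrow> \<bar>h (1 / v - 1) - g v\<bar> < e"
      by blast
    from g obtain a and m :: nat where ga: "g = (\<lambda>x. \<Sum>i\<le>m. a i * x ^ i)"
      using real_polynomial_function_iff_sum by blast
    define q where "q u = g (1 / (1 + u))" for u
    have q_close: "\<bar>h u - q u\<bar> < e" if "u \<in> {0..T}" for u
      using ge[of "1 / (1 + u)"] that T by (auto simp: q_def field_simps)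
    have q_cont [continuous_intros]: "continuous_on {0..T} q"
      unfolding q_def ga by (intro continuous_intros cont_pow)
    have "integral {0..T} (\<lambda>u. w u * h u * q u)
        = integral {0..T} (\<lambda>u. \<Sum>i\<le>m. a i * (w u * h u * (1 / (1 + u)) ^ i))"
      unfolding q_def ga by (simp add: sum_distrib_left mult_ac)
    also have "\<dots> = (\<Sum>i\<le>m. integral {0..T} (\<lambda>u. a i * (w u * h u * (1 / (1 + u)) ^ i)))"
      by (intro integral_sum) (auto intro!: integrable_continuous_real continuous_intros cont_pow)
    also have "\<dots> = 0"
      by (simp add: power_zero del: power_one_over)
    finally have q_zero: "integral {0..T} (\<lambda>u. w u * h u * q u) = 0" .
    \<comment> \<open>Subtracting the vanishing integral replaces \<open>h * h\<close> by
      \<open>h * (h - q)\<close>, whose second factor is smaller than \<open>e\<close>.\<close>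
    have "integral {0..T} (\<lambda>u. w u * (h u)\<^sup>2)
        = integral {0..T} (\<lambda>u. w u * (h u)\<^sup>2) - integral {0..T} (\<lambda>u. w u * h u * q u)"
      by (simp add: q_zero)
    also have "\<dots> = integral {0..T} (\<lambda>u. w u * (h u)\<^sup>2 - w u * h u * q u)"
      by (intro integral_diff[symmetric]) (auto intro!: integrable_continuous_real continuous_intros)
    also have "\<dots> \<le> integral {0..T} (\<lambda>u. e * (w u * \<bar>h u\<bar>))"
    proof (rule integral_le)
      fix u assume u: "u \<in> {0..T}"
      have "w u * (h u)\<^sup>2 - w u * h u * q u = (w u * h u) * (h u - q u)"
        by (simp add: algebra_simps power2_eq_square)
      also have "\<dots> \<le> \<bar>w u * h u\<bar> * \<bar>h u - q u\<bar>"
        by (simp flip: abs_mult)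
      also have "\<dots> \<le> \<bar>w u * h u\<bar> * e"
        using q_close[OF u] by (intro mult_left_mono) auto
      finally show "w u * (h u)\<^sup>2 - w u * h u * q u \<le> e * (w u * \<bar>h u\<bar>)"
        using w_pos[OF u] by (simp add: abs_mult mult_ac)
    qed (auto intro!: integrable_continuous_real continuous_intros)
    also have "\<dots> = e * B"
      by (simp add: B_def)
    finally show ?thesis .
  qed
  have w_nonneg: "w u \<ge> 0" for u
    by (simp add: w_def)
  have "B \<ge> 0"
    unfolding B_def using w_nonneg by (intro integral_nonneg) (auto intro!: integrable_continuous_real continuous_intros)
  have "integral {0..T} (\<lambda>u. w u * (h u)\<^sup>2) \<le> e" if "e > 0" for e
  proof -
    \<comment> \<open>\<open>B + 1\<close> instead of \<open>B\<close> covers the case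
      \<open>B = 0\<close>.\<close>
    have "integral {0..T} (\<lambda>u. w u * (h u)\<^sup>2) \<le> e / (B + 1) * B"
      using that \<open>B \<ge> 0\<close> by (intro square_le) auto
    also have "\<dots> \<le> e"
      using that \<open>B \<ge> 0\<close> by (simp add: field_simps)
    finally show ?thesis .
  qed
  then have "integral {0..T} (\<lambda>u. w u * (h u)\<^sup>2) \<le> 0"
    using field_le_epsilon[of _ "0::real"] by simp
  moreover have "integral {0..T} (\<lambda>u. w u * (h u)\<^sup>2) \<ge> 0"
    using w_nonneg by (intro integral_nonneg) (auto intro!: integrable_continuous_real continuous_intros)
  ultimately have "integral {0..T} (\<lambda>u. w u * (h u)\<^sup>2) = 0"
    by simp
  then have "\<forall>u\<in>{0..T}. w u * (h u)\<^sup>2 = 0"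
    using w_nonneg T by (subst (asm) integral_eq_0_iff) (auto intro!: continuous_intros)
  then have "w u * (h u)\<^sup>2 = 0"
    using u by blast
  with w_pos[OF u] show ?thesis by simp
qed

subsection \<open>Iterated derivatives on the positive half-line\<close>

text \<open>The half-line is open, so a derivative at \<open>t > 0\<close> sees only values at
  positive arguments. Formulas valid there may therefore be substituted under
  \<open>deriv\<close>.\<close>

lemma deriv_cong_pos:
  fixes f g :: "real \<Rightarrow> real"
  assumes "\<And>s. s > 0 \<Longrightarrow> f s = g s" and "t > 0"
  shows "deriv f t = deriv g t"
proof (rule deriv_cong_ev)
  have "eventually (\<lambda>s. s \<in> {0<..}) (nhds t)"
    using assms(2) by (intro eventually_nhds_in_open) auto
  then show "eventually (\<lambda>s. f s = g s) (nhds t)"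
    by eventually_elim (use assms(1) in auto)
qed simp

lemma higher_deriv_cong_pos:
  fixes f g :: "real \<Rightarrow> real"
  assumes "\<And>s. s > 0 \<Longrightarrow> f s = g s" and "t > 0"
  shows "(deriv ^^ k) f t = (deriv ^^ k) g t"
  using assms(2) by (induction k arbitrary: t) (auto intro: deriv_cong_pos assms(1))

lemma higher_deriv_shift:
  fixes f :: "real \<Rightarrow> real"
  shows "(deriv ^^ k) f (t + c) = (deriv ^^ k) (\<lambda>s. f (s + c)) t"
proof (induction k arbitrary: t)
  case (Suc k)
  have "(deriv ^^ k) (\<lambda>s. f (s + c)) = (\<lambda>t. (deriv ^^ k) f (t + c))"
    using Suc by auto
  moreover have "deriv g (t + c) = deriv (\<lambda>s. g (s + c)) t" for g :: "real \<Rightarrow> real"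
    by (simp add: deriv_def DERIV_shift)
  ultimately show ?case
    by simp
qed simp

lemma higher_deriv_periodic:
  fixes f :: "real \<Rightarrow> real"
  assumes f: "\<And>t. t > 0 \<Longrightarrow> f (t + T) = f t" and t: "t > 0"
  shows "(deriv ^^ k) f (t + T) = (deriv ^^ k) f t"
  unfolding higher_deriv_shift by (rule higher_deriv_cong_pos) (use f t in auto)

text \<open>Excludes default values of \<open>deriv\<close> up to order \<open>n\<close>; iterates
  of \<open>deriv\<close> can then be split over sums, as in
  \<open>higher_deriv_add_pos\<close>.\<close>

definition times_differentiable_pos :: "nat \<Rightarrow> (real \<Rightarrow> real) \<Rightarrow> bool" where
  "times_differentiable_pos n f \<longleftrightarrow> (\<forall>k<n. \<forall>t>0. (deriv ^^ k) f differentiable (at t))"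

lemma differentiable_cong_pos:
  fixes f g :: "real \<Rightarrow> real"
  assumes "f differentiable (at t)" "\<And>s. s > 0 \<Longrightarrow> f s = g s" and "t > 0"
  shows "g differentiable (at t)"
proof -
  from assms(1) obtain D where "(f has_real_derivative D) (at t)"
    using real_differentiable_def by blast
  then have "(g has_real_derivative D) (at t)"
    by (rule has_field_derivative_transform_within_open[where S = "{0<..}"]) (use assms in auto)
  then show ?thesis
    using real_differentiable_def by blast
qed

lemma times_differentiable_pos_0: "times_differentiable_pos 0 f"
  by (simp add: times_differentiable_pos_def)

text \<open>Peels off the innermost derivative: \<open>f'\<close> and \<open>deriv f\<close> agree
  at positive arguments, hence so do their iterated derivatives.\<close>

lemma times_differentiable_pos_Suc:
  assumes "\<And>t. t > 0 \<Longrightarrow> (f has_real_derivative f' t) (at t)" and "times_differentiable_pos n f'"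
  shows "times_differentiable_pos (Suc n) f"
  unfolding times_differentiable_pos_def
proof (intro allI impI)
  fix k and t :: real assume k: "k < Suc n" and t: "t > 0"
  show "(deriv ^^ k) f differentiable at t"
  proof (cases k)
    case 0
    then show ?thesis using assms(1)[OF t] real_differentiable_def by auto
  next
    case (Suc j)
    have "f' s = deriv f s" if "s > 0" for s
      using DERIV_imp_deriv[OF assms(1)[OF that]] by simp
    then have "(deriv ^^ j) f' s = (deriv ^^ j) (deriv f) s" if "s > 0" for s
      using that by (rule higher_deriv_cong_pos)
    moreover have "(deriv ^^ j) f' differentiable at t"
      using assms(2) Suc k t by (simp add: times_differentiable_pos_def)
    ultimately show ?thesis
      unfolding Suc funpow_Suc_right o_def by (metis differentiable_cong_pos t)
  qed
qed

lemma higher_deriv_add_pos: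
  assumes "times_differentiable_pos n f" "times_differentiable_pos n g" "k \<le> n" "t > 0"
  shows "(deriv ^^ k) (\<lambda>s. f s + g s) t = (deriv ^^ k) f t + (deriv ^^ k) g t"
  using assms(3,4)
proof (induction k arbitrary: t)
  case (Suc k)
  have "deriv ((deriv ^^ k) (\<lambda>s. f s + g s)) t = deriv (\<lambda>s. (deriv ^^ k) f s + (deriv ^^ k) g s) t"
    using Suc by (intro deriv_cong_pos) auto
  also have "\<dots> = deriv ((deriv ^^ k) f) t + deriv ((deriv ^^ k) g) t"
  proof (rule deriv_add)
    show "(deriv ^^ k) f field_differentiable at t" "(deriv ^^ k) g field_differentiable at t"
      using assms(1,2) Suc.prems unfolding times_differentiable_pos_def real_differentiable_def field_differentiable_def
      by (auto simp: Suc_le_eq)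
  qed
  finally show ?case by simp
qed simp

lemma times_differentiable_pos_add:
  assumes "times_differentiable_pos n f" "times_differentiable_pos n g"
  shows "times_differentiable_pos n (\<lambda>s. f s + g s)"
  unfolding times_differentiable_pos_def
proof (intro allI impI)
  fix k and t :: real assume k: "k < n" and t: "t > 0"
  have "(\<lambda>s. (deriv ^^ k) f s + (deriv ^^ k) g s) differentiable at t"
    using assms k t by (intro differentiable_add) (auto simp: times_differentiable_pos_def)
  then show "(deriv ^^ k) (\<lambda>s. f s + g s) differentiable at t"
    by (rule differentiable_cong_pos) (use k t higher_deriv_add_pos[OF assms] in auto)
qed

text \<open>Lets explicit formulas for the successive derivatives do the work; the induction drops
  the first function of the sequence.\<close>

lemma times_differentiable_pos_chain:
  assumes "\<And>k t. k < n \<Longrightarrow> t > 0 \<Longrightarrow> (F k has_real_derivative F (Suc k) t) (at t)"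
  shows "times_differentiable_pos n (F 0)"
  using assms
proof (induction n arbitrary: F)
  case (Suc n)
  show ?case
  proof (rule times_differentiable_pos_Suc)
    show "times_differentiable_pos n (F (Suc 0))"
      by (rule Suc.IH[of "\<lambda>k. F (Suc k)"]) (rule Suc.prems; simp)
    show "(F 0 has_real_derivative F (Suc 0) t) (at t)" if "t > 0" for t
      using Suc.prems[of 0 t] that by simp
  qed
qed (rule times_differentiable_pos_0)

lemma higher_deriv_chain:
  assumes "\<And>k t. k < n \<Longrightarrow> t > 0 \<Longrightarrow> (F k has_real_derivative F (Suc k) t) (at t)"
    and "k \<le> n" "t > 0"
  shows "(deriv ^^ k) (F 0) t = F k t"
  using assms(2,3)
proof (induction k arbitrary: t)
  case (Suc k)
  have "deriv ((deriv ^^ k) (F 0)) t = deriv (F k) t"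
    by (rule deriv_cong_pos) (use Suc in \<open>simp_all add: less_imp_le\<close>)
  also have "\<dots> = F (Suc k) t"
    by (rule DERIV_imp_deriv, rule assms(1)) (use Suc.prems in simp_all)
  finally show ?case by simp
qed simp

section \<open>Periodic extension to the whole line\<close>

lemma periodic_add_mult:
  assumes "\<And>t. t > 0 \<Longrightarrow> f (t + T) = (f t :: real)" and "t > 0" "T > 0"
  shows "f (t + real m * T) = f t"
proof (induction m)
  case (Suc m)
  have "f (t + real m * T + T) = f (t + real m * T)"
    using assms by (intro assms(1)) (simp add: add_pos_nonneg)
  with Suc show ?case by (simp add: algebra_simps)
qed simp

text \<open>Each \<open>t\<close> is carried into the half-line by enough periods, and the
  derivatives of \<open>x\<close> are read off there. \<open>P k\<close> is the \<open>k\<close>-th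
  derivative of the extension for \<open>k \<le> n\<close>.\<close>

lemma periodic_extension:
  assumes T: "T > 0" and C: "class_C_on n {0<..} x" and per: "periodic_on_pos T x"
  obtains P :: "nat \<Rightarrow> real \<Rightarrow> real" where
    "\<And>t. t > 0 \<Longrightarrow> P 0 t = x t"
    "\<And>k t. k < n \<Longrightarrow> (P k has_real_derivative P (Suc k) t) (at t)"
    "continuous_on UNIV (P n)"
    "\<And>k t. P k (t + T) = P k t"
proof -
  define D where "D k = (deriv ^^ k) x" for k
  have D_per: "D k (t + T) = D k t" if "t > 0" for k t
    unfolding D_def using per that by (intro higher_deriv_periodic) (auto simp: periodic_on_pos_def)
  \<comment> \<open>Enough periods to make \<open>t + real (m t) * T\<close> positive; the summand 1
    makes the inequality strict.\<close>
  define m where "m t = nat \<lceil>\<bar>t\<bar> / T\<rceil> + 1" for t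
  define P where "P k t = D k (t + real (m t) * T)" for k t
  have m_pos: "t + real (m t) * T > 0" for t
  proof -
    have "\<bar>t\<bar> / T < real (m t)"
      unfolding m_def by linarith
    then have "\<bar>t\<bar> < real (m t) * T"
      using T by (simp add: field_simps)
    then show ?thesis by linarith
  qed
  \<comment> \<open>The number of periods is immaterial as long as the half-line is reached: both
    values equal the one after \<open>m t + j\<close> periods.\<close>
  have P_eq: "P k t = D k (t + real j * T)" if "t + real j * T > 0" for k t j
  proof -
    have "D k (t + real (m t) * T + real j * T) = P k t"
      unfolding P_def using D_per m_pos T by (intro periodic_add_mult) auto
    moreover have "D k (t + real j * T + real (m t) * T) = D k (t + real j * T)"
      using D_per that T by (intro periodic_add_mult) auto
    ultimately show ?thesis by (simp add: algebra_simps)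
  qed
  \<comment> \<open>The number \<open>m t\<close> also serves all points near \<open>t\<close>, so
    \<open>P k\<close> is locally a translate of \<open>D k\<close> and inherits its
    regularity.\<close>
  have near: "eventually (\<lambda>s. P k s = D k (s + real (m t) * T)) (nhds t)" for k t
  proof -
    have "eventually (\<lambda>s. s \<in> {- real (m t) * T<..}) (nhds t)"
      using m_pos[of t] by (intro eventually_nhds_in_open) (auto simp: algebra_simps)
    then show ?thesis
      by eventually_elim (rule P_eq, simp)
  qed
  show thesis
  proof (rule that[of P])
    show "P 0 t = x t" if "t > 0" for t
      using P_eq[of t 0 0] that by (simp add: D_def)
    show "(P k has_real_derivative P (Suc k) t) (at t)" if "k < n" for k t
    proof -
      have "(D k has_real_derivative D (Suc k) (t + real (m t) * T)) (at (t + real (m t) * T))"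
        using C that m_pos[of t] unfolding class_C_on_def D_def
        by (auto simp: DERIV_deriv_iff_real_differentiable)
      then have "((\<lambda>s. D k (s + real (m t) * T)) has_real_derivative P (Suc k) t) (at t)"
        by (simp add: DERIV_shift P_def)
      then show ?thesis
        using DERIV_cong_ev[OF refl near[of k t] refl] by blast
    qed
    show "continuous_on UNIV (P n)"
      unfolding continuous_on_eq_continuous_at[OF open_UNIV]
    proof
      fix t
      have "isCont (D n) (t + real (m t) * T)"
        using C m_pos[of t] unfolding class_C_on_def D_def
        by (auto simp: continuous_on_eq_continuous_at)
      then have "isCont (\<lambda>s. D n (s + real (m t) * T)) t"
        by (rule isCont_o2[rotated]) simp
      then show "isCont (P n) t"
        by (subst isCont_cong[OF near[of n t]])
    qed
    show "P k (t + T) = P k t" for k t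
    proof -
      have "P k (t + T) = D k (t + T + real (m t) * T)"
        using m_pos[of t] T by (intro P_eq) linarith
      also have "\<dots> = D k (t + real (m t) * T + T)"
        by (simp add: algebra_simps)
      also have "\<dots> = P k t"
        unfolding P_def by (rule D_per[OF m_pos])
      finally show ?thesis .
    qed
  qed
qed

subsection \<open>The Riemann-Liouville derivative\<close>

lemma higher_deriv_power_moment:
  assumes h: "continuous_on {0..T} h" and t: "t > 0"
  shows "(deriv ^^ n) (power_moment T h c) t = (\<Prod>i<n. c - real i) * power_moment T h (c - real n) t"
    and "times_differentiable_pos n (power_moment T h c)"
proof -
  define F where "F k t = (\<Prod>i<k. c - real i) * power_moment T h (c - real k) t" for k t
  have F: "(F k has_real_derivative F (Suc k) t) (at t)" if "t > 0" for k t
  proof -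
    have "(F k has_real_derivative (\<Prod>i<k. c - real i) * ((c - real k) * power_moment T h (c - real k - 1) t)) (at t)"
      unfolding F_def by (intro DERIV_cmult DERIV_power_moment h that)
    then show ?thesis by (simp add: F_def algebra_simps)
  qed
  have F0: "F 0 = power_moment T h c" by (auto simp: F_def)
  show "times_differentiable_pos n (power_moment T h c)"
    unfolding F0[symmetric] by (rule times_differentiable_pos_chain) (rule F)
  show "(deriv ^^ n) (power_moment T h c) t = (\<Prod>i<n. c - real i) * power_moment T h (c - real n) t"
    unfolding F0[symmetric] F_def[symmetric] by (rule higher_deriv_chain[where n = n]) (use F t in auto)
qed

text \<open>The substitution \<open>w = (1 - s / t) powr \<beta>\<close> removes the singularity of the kernel at \<open>s = t\<close>.\<close>

lemma fractional_integral_substitution: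
  fixes p :: "real \<Rightarrow> real"
  assumes \<beta>: "\<beta> > 0" and t: "t > 0" and p: "continuous_on UNIV p"
  shows "((\<lambda>s. (t - s) powr (\<beta> - 1) * p s) has_integral
     t powr \<beta> / \<beta> * integral {0..1} (\<lambda>w. p (t * (1 - w powr (1 / \<beta>))))) {0..t}"
proof -
  define f where "f w = p (t * (1 - w powr (1 / \<beta>)))" for w
  define g where "g s = ((t - s) / t) powr \<beta>" for s
  define g' where "g' s = - (\<beta> / t) * ((t - s) / t) powr (\<beta> - 1)" for s
  have "((\<lambda>s. g' s *\<^sub>R f (g s)) has_integral (integral {g 0..g t} f - integral {g t..g 0} f)) {0..t}"
  \<comment> \<open>\<open>g\<close> may fail to be differentiable at \<open>s = t\<close>, where
    the base of the power vanishes; this end point is the exceptional set.\<close>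
  proof (rule has_integral_substitution_general[where s = "{t}" and c = 0 and d = 1])
    show "g ` {0..t} \<subseteq> {0..1}"
    proof (intro image_subsetI)
      fix s assume "s \<in> {0..t}"
      then have "(t - s) / t \<in> {0..1}" using t by (auto simp: field_simps)
      then show "g s \<in> {0..1}"
        using \<beta> by (auto simp: g_def powr_le1)
    qed
    show "continuous_on {0..1} f"
      unfolding f_def using \<beta>
      by (intro continuous_on_compose2[OF p] continuous_intros continuous_on_powr') auto
    show "continuous_on {0..t} g"
      unfolding g_def using \<beta> t by (intro continuous_on_powr' continuous_intros) auto
    show "(g has_field_derivative g' s) (at s within {0..t})" if "s \<in> {0..t} - {t}" for s
      unfolding g_def g'_def using that t
      by (auto intro!: derivative_eq_intros simp: powr_diff powr_divide field_simps)
  qed (use t in auto)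
  \<comment> \<open>\<open>g\<close> decreases from 1 to 0, so the integral over
    \<open>{g 0..g t}\<close> is zero and the other one enters with a minus sign.\<close>
  then have "((\<lambda>s. g' s * f (g s)) has_integral - integral {0..1} f) {0..t}"
    using t \<beta> by (simp add: g_def)
  from has_integral_mult_right[OF this, of "- (t powr \<beta> / \<beta>)"]
  have "((\<lambda>s. - (t powr \<beta> / \<beta>) * (g' s * f (g s))) has_integral t powr \<beta> / \<beta> * integral {0..1} f) {0..t}"
    by simp
  \<comment> \<open>This includes \<open>s = t\<close>: both sides vanish there, since
    \<open>0 powr (\<beta> - 1) = 0\<close>.\<close>
  moreover have "- (t powr \<beta> / \<beta>) * (g' s * f (g s)) = (t - s) powr (\<beta> - 1) * p s" if "s \<in> {0..t}" for s
  proof -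
    have "g s powr (1 / \<beta>) = (t - s) / t"
      using that t \<beta> by (simp add: g_def powr_powr)
    moreover have "t * (1 - (t - s) / t) = s"
      using t by (simp add: field_simps)
    ultimately have "f (g s) = p s"
      by (simp add: f_def)
    moreover have "- (t powr \<beta> / \<beta>) * g' s = (t - s) powr (\<beta> - 1)"
      using that t \<beta> by (simp add: g'_def powr_divide powr_diff)
    ultimately show ?thesis by (simp add: mult.assoc[symmetric])
  qed
  ultimately show ?thesis
    unfolding f_def by (rule has_integral_eq[rotated])
qed

text \<open>The domain is fixed and \<open>t\<close> occurs only inside \<open>p\<close>, so one may
  differentiate under the integral. The factor \<open>\<phi>\<close> collects the powers of
  \<open>v\<close> produced by earlier differentiations.\<close>

lemma DERIV_dilation_integral:
  fixes p p' \<phi> v :: "real \<Rightarrow> real"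
  assumes p: "\<And>t. (p has_real_derivative p' t) (at t)" and p': "continuous_on UNIV p'"
    and v: "continuous_on {0..1} v" and \<phi>: "continuous_on {0..1} \<phi>"
  shows "((\<lambda>t. integral {0..1} (\<lambda>w. \<phi> w * p (t * v w))) has_real_derivative
    integral {0..1} (\<lambda>w. \<phi> w * v w * p' (t * v w))) (at t)"
proof -
  have "((\<lambda>t. integral (cbox 0 1) (\<lambda>w. \<phi> w * p (t * v w))) has_field_derivative
      integral (cbox 0 1) (\<lambda>w. \<phi> w * v w * p' (t * v w))) (at t within UNIV)"
  proof (rule leibniz_rule_field_derivative)
    show "((\<lambda>t. \<phi> w * p (t * v w)) has_field_derivative \<phi> w * v w * p' (s * v w)) (at s within UNIV)"
      for s w
      by (auto intro!: derivative_eq_intros DERIV_chain2[OF p])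
    have "continuous_on UNIV p"
      using p by (meson DERIV_isCont continuous_at_imp_continuous_on)
    then have "continuous_on {0..1} (\<lambda>w. p (s * v w))" for s
      by (rule continuous_on_compose2) (auto intro!: continuous_intros v)
    then show "(\<lambda>w. \<phi> w * p (s * v w)) integrable_on cbox 0 1" for s
      by (auto intro!: integrable_continuous_real continuous_intros \<phi>)
    have [continuous_intros]: "continuous_on (UNIV \<times> {0..1}) (\<lambda>x. v (snd x))"
       "continuous_on (UNIV \<times> {0..1}) (\<lambda>x. \<phi> (snd x))"
      using v \<phi> by (auto intro: continuous_on_compose2[OF _ continuous_on_snd[OF continuous_on_id]])
    have "continuous_on (UNIV \<times> {0..1}) (\<lambda>x. p' (fst x * v (snd x)))"
      by (rule continuous_on_compose2[OF p']) (auto intro!: continuous_intros)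
    then show "continuous_on (UNIV \<times> cbox 0 1) (\<lambda>(s, w). \<phi> w * v w * p' (s * v w))"
      by (auto simp: case_prod_unfold intro!: continuous_intros)
  qed auto
  then show ?thesis by simp
qed

text \<open>The product rule yields two terms of the same shape, one with exponent
  \<open>c - 1\<close> and one with \<open>A (Suc j)\<close>; the induction therefore runs over all
  \<open>a\<close>, \<open>c\<close> and \<open>j\<close>.\<close>

lemma times_differentiable_pos_powr_mult:
  assumes "\<And>j t. j < N \<Longrightarrow> t > 0 \<Longrightarrow> (A j has_real_derivative A (Suc j) t) (at t)" and "j + n \<le> N"
  shows "times_differentiable_pos n (\<lambda>t. a * (t powr c * A j t))"
  using assms(2)
proof (induction n arbitrary: j c a)
  case (Suc n)
  show ?case
  proof (rule times_differentiable_pos_Suc[where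
      f' = "\<lambda>t. (a * c) * (t powr (c - 1) * A j t) + a * (t powr c * A (Suc j) t)"])
    fix t :: real assume t: "t > 0"
    have "(A j has_real_derivative A (Suc j) t) (at t)"
      using Suc.prems t by (intro assms(1)) auto
    moreover have "((\<lambda>t. t powr c) has_real_derivative c * t powr (c - 1)) (at t)"
      using t by (rule has_real_derivative_powr)
    ultimately show "((\<lambda>t. a * (t powr c * A j t)) has_real_derivative
      (a * c) * (t powr (c - 1) * A j t) + a * (t powr c * A (Suc j) t)) (at t)"
      using t by (auto intro!: derivative_eq_intros simp: algebra_simps)
  next
    show "times_differentiable_pos n (\<lambda>t. (a * c) * (t powr (c - 1) * A j t) + a * (t powr c * A (Suc j) t))"
      using Suc.prems by (intro times_differentiable_pos_add Suc.IH) auto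
  qed
qed (rule times_differentiable_pos_0)

lemma times_differentiable_fractional_integral:
  fixes P :: "nat \<Rightarrow> real \<Rightarrow> real"
  assumes \<beta>: "\<beta> > 0"
    and D: "\<And>k t. k < n \<Longrightarrow> (P k has_real_derivative P (Suc k) t) (at t)"
    and cont: "continuous_on UNIV (P n)"
  shows "times_differentiable_pos n (\<lambda>t. t powr \<beta> / \<beta> * integral {0..1} (\<lambda>w. P 0 (t * (1 - w powr (1 / \<beta>)))))"
proof -
  define v where "v w = 1 - w powr (1 / \<beta>)" for w
  \<comment> \<open>Each derivative in \<open>t\<close> brings out one factor \<open>v w\<close>, so
    \<open>A k\<close> is the \<open>k\<close>-th derivative of \<open>A 0\<close> for
    \<open>k \<le> n\<close>.\<close>
  define A where "A k t = integral {0..1} (\<lambda>w. v w ^ k * P k (t * v w))" for k t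
  have v: "continuous_on {0..1} v"
    unfolding v_def using \<beta> by (intro continuous_intros continuous_on_powr') auto
  have P_cont: "continuous_on UNIV (P k)" if "k \<le> n" for k
  proof (cases "k = n")
    case False
    then show ?thesis
      using that by (intro DERIV_continuous_on[OF D]) auto
  qed (use cont in simp)
  have "(A j has_real_derivative A (Suc j) t) (at t)" if "j < n" for j t
    using DERIV_dilation_integral[OF D[OF that] P_cont[of "Suc j"] v, of "\<lambda>w. v w ^ j" t] that
    by (simp add: A_def[abs_def] mult_ac continuous_on_power[OF v])
  then have "times_differentiable_pos n (\<lambda>t. 1 / \<beta> * (t powr \<beta> * A 0 t))"
    by (intro times_differentiable_pos_powr_mult[where N = n]) auto
  then show ?thesis by (simp add: A_def v_def)
qed

text \<open>Split at \<open>T\<close>. The part beyond \<open>T\<close> is a translate of the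
  integral up to \<open>t\<close>; on \<open>{0..T}\<close> the substitution
  \<open>s = T - u\<close> gives the kernel \<open>(t + u) powr (\<beta> - 1)\<close>, which has no
  singularity.\<close>

lemma fractional_integral_shift:
  fixes p :: "real \<Rightarrow> real"
  assumes \<beta>: "\<beta> > 0" and t: "t > 0" and T: "T > 0" and p: "continuous_on UNIV p"
    and per: "\<And>s. p (s + T) = p s"
  shows "integral {0..t + T} (\<lambda>s. (t + T - s) powr (\<beta> - 1) * p s) =
    integral {0..t} (\<lambda>s. (t - s) powr (\<beta> - 1) * p s) + power_moment T (\<lambda>u. p (- u)) (\<beta> - 1) t"
proof -
  define f where "f s = (t + T - s) powr (\<beta> - 1) * p s" for s
  have "f integrable_on {0..t + T}"
    unfolding f_def using fractional_integral_substitution[OF \<beta> _ p, of "t + T"] t T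
    by (intro has_integral_integrable) auto
  then have "integral {0..t + T} f = integral {0..T} f + integral {T..t + T} f"
    using t T by (intro Henstock_Kurzweil_Integration.integral_combine[symmetric]) auto
  moreover have "integral {T..t + T} f = integral {0..t} (\<lambda>s. f (s + T))"
    using integral_shift_real_ivl[of T T "t + T" f] by simp
  moreover have "integral {0..T} f = integral {0..T} (\<lambda>u. f (T - u))"
  proof -
    have "integral {- T..- 0} (\<lambda>x. f (- x)) = integral {0..T} f"
      by (rule Henstock_Kurzweil_Integration.integral_reflect_real)
    then show ?thesis
      using integral_shift_real_ivl[of "-T" "-T" 0 "\<lambda>x. f (- x)"] by (simp del: Henstock_Kurzweil_Integration.integral_reflect_real)
  qed
  moreover have "p (T - u) = p (- u)" for u
    using per[of "- u"] by (simp add: add.commute)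
  ultimately show ?thesis
    by (simp add: f_def[abs_def] power_moment_def per algebra_simps)
qed

text \<open>The \<open>n\<close>-th derivative of \<open>fractional_integral_shift\<close> isolates
  that of the power moment, and \<open>n\<close> differentiations lower the exponent
  \<open>\<beta> - 1\<close> to \<open>- \<alpha> - 1\<close>.\<close>

lemma RL_deriv_periodic_imp:
  fixes P :: "nat \<Rightarrow> real \<Rightarrow> real"
  assumes n: "n = nat \<lfloor>\<alpha>\<rfloor> + 1" "real n - 1 < \<alpha>" "\<alpha> < real n" and T: "T > 0"
    and D: "\<And>k t. k < n \<Longrightarrow> (P k has_real_derivative P (Suc k) t) (at t)"
    and cont: "continuous_on UNIV (P n)"
    and per: "\<And>t. P 0 (t + T) = P 0 t"
    and g: "\<And>t. t \<ge> 0 \<Longrightarrow> g t = P 0 t"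
    and RL: "periodic_on_pos T (RL_deriv \<alpha> g)" and t: "t > 0"
  shows "power_moment T (\<lambda>u. P 0 (- u)) (- \<alpha> - 1) t = 0"
proof -
  define \<beta> where "\<beta> = real n - \<alpha>"
  define h where "h u = P 0 (- u)" for u
  define I where "I u = integral {0..u} (\<lambda>s. (u - s) powr (\<beta> - 1) * g s)" for u
  have \<beta>: "\<beta> > 0" "\<beta> < 1"
    using n(2,3) by (auto simp: \<beta>_def)
  have P0: "continuous_on UNIV (P 0)"
    using D[of 0] n(1) by (auto intro: DERIV_continuous_on)
  have h_cont: "continuous_on {0..T} h"
    unfolding h_def by (intro continuous_on_compose2[OF P0] continuous_intros) auto
  have I_eq: "I u = integral {0..u} (\<lambda>s. (u - s) powr (\<beta> - 1) * P 0 s)" for u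
    unfolding I_def by (rule integral_cong) (use g in auto)
  have I_eq': "I u = u powr \<beta> / \<beta> * integral {0..1} (\<lambda>w. P 0 (u * (1 - w powr (1 / \<beta>))))" if "u > 0" for u
    unfolding I_eq by (rule integral_unique[OF fractional_integral_substitution]) (use \<beta> that P0 in auto)
  \<comment> \<open>Regularity is known for the substituted form and passes to \<open>I\<close>,
    which agrees with it at positive arguments. It justifies splitting the \<open>n\<close>-th
    derivative of the sum below.\<close>
  have I_diff: "times_differentiable_pos n I"
    using times_differentiable_fractional_integral[OF \<beta>(1) D cont] I_eq'
    unfolding times_differentiable_pos_def
    by (smt (verit) differentiable_cong_pos higher_deriv_cong_pos)
  have "RL_deriv \<alpha> g (t + T) = RL_deriv \<alpha> g t"
    using RL t by (simp add: periodic_on_pos_def)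
  moreover have "Gamma \<beta> \<noteq> 0"
    using Gamma_real_pos[OF \<beta>(1)] by simp
  ultimately have "(deriv ^^ n) I (t + T) = (deriv ^^ n) I t"
    unfolding RL_deriv_def Let_def n(1)[symmetric] \<beta>_def[symmetric] I_def[symmetric] by simp
  moreover have "(deriv ^^ n) I (t + T) = (deriv ^^ n) I t + (deriv ^^ n) (power_moment T h (\<beta> - 1)) t"
  proof -
    have "I (s + T) = I s + power_moment T h (\<beta> - 1) s" if "s > 0" for s
      unfolding I_eq h_def using fractional_integral_shift[OF \<beta>(1) that T P0 per] by simp
    then have "(deriv ^^ n) (\<lambda>s. I (s + T)) t = (deriv ^^ n) (\<lambda>s. I s + power_moment T h (\<beta> - 1) s) t"
      using t by (rule higher_deriv_cong_pos)
    also have "\<dots> = (deriv ^^ n) I t + (deriv ^^ n) (power_moment T h (\<beta> - 1)) t"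
      by (rule higher_deriv_add_pos[OF I_diff higher_deriv_power_moment(2)[OF h_cont t]]) (use t in auto)
    finally show ?thesis by (simp add: higher_deriv_shift)
  qed
  ultimately have "(\<Prod>i<n. \<beta> - 1 - real i) * power_moment T h (\<beta> - 1 - real n) t = 0"
    by (simp add: higher_deriv_power_moment(1)[OF h_cont t])
  \<comment> \<open>All factors are negative because \<open>\<beta> < 1\<close>.\<close>
  moreover have "(\<Prod>i<n. \<beta> - 1 - real i) \<noteq> 0"
    using \<beta> by (subst prod_zero_iff) auto
  moreover have "\<beta> - 1 - real n = - \<alpha> - 1"
    by (simp add: \<beta>_def)
  ultimately show ?thesis by (simp add: h_def[abs_def])
qed

subsection \<open>Riemann sums with power weights\<close>

lemma tendsto_nat_ceiling_mult:
  "s > 0 \<Longrightarrow> ((\<lambda>h. real (nat \<lceil>s / h\<rceil>) * h) \<longlongrightarrow> s) (at_right 0)"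
proof (rule tendsto_sandwich)
  assume s: "s > 0"
  have pos: "eventually (\<lambda>h::real. h > 0) (at_right 0)"
    by (simp add: eventually_at_right_less)
  show "eventually (\<lambda>h. s \<le> real (nat \<lceil>s / h\<rceil>) * h) (at_right 0)"
    using pos
  proof eventually_elim
    case (elim h)
    have "s / h \<le> real (nat \<lceil>s / h\<rceil>)" by linarith
    with elim show ?case by (simp add: field_simps)
  qed
  show "eventually (\<lambda>h. real (nat \<lceil>s / h\<rceil>) * h \<le> s + h) (at_right 0)"
    using pos
  proof eventually_elim
    case (elim h)
    have "s / h > 0" using elim s by simp
    then have "real (nat \<lceil>s / h\<rceil>) \<le> s / h + 1" by linarith
    with elim show ?case by (simp add: field_simps)
  qed
  have "((\<lambda>h. s + h) \<longlongrightarrow> s + 0) (at_right 0)"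
    by (intro tendsto_intros)
  then show "((\<lambda>h. s + h) \<longlongrightarrow> s) (at_right 0)" by simp
qed auto

lemma tendsto_nat_floor_mult:
  "s > 0 \<Longrightarrow> ((\<lambda>h. real (nat \<lfloor>s / h\<rfloor>) * h) \<longlongrightarrow> s) (at_right 0)"
proof (rule tendsto_sandwich)
  assume s: "s > 0"
  have pos: "eventually (\<lambda>h::real. h > 0) (at_right 0)"
    by (simp add: eventually_at_right_less)
  show "eventually (\<lambda>h. s - h \<le> real (nat \<lfloor>s / h\<rfloor>) * h) (at_right 0)"
    using pos
  proof eventually_elim
    case (elim h)
    have "s / h - 1 \<le> real (nat \<lfloor>s / h\<rfloor>)" by linarith
    with elim show ?case by (simp add: field_simps)
  qed
  show "eventually (\<lambda>h. real (nat \<lfloor>s / h\<rfloor>) * h \<le> s) (at_right 0)"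
    using pos
  proof eventually_elim
    case (elim h)
    have "s / h > 0" using elim s by simp
    then have "real (nat \<lfloor>s / h\<rfloor>) \<le> s / h" by linarith
    with elim show ?case by (simp add: field_simps)
  qed
  have "((\<lambda>h. s - h) \<longlongrightarrow> s - 0) (at_right 0)"
    by (intro tendsto_intros)
  then show "((\<lambda>h. s - h) \<longlongrightarrow> s) (at_right 0)" by simp
qed auto

lemma filterlim_divide_at_right_0:
  "s > 0 \<Longrightarrow> filterlim (\<lambda>h::real. s / h) at_top (at_right 0)"
  unfolding divide_inverse
  by (intro filterlim_tendsto_pos_mult_at_top[OF tendsto_const] filterlim_inverse_at_top_right)

lemma filterlim_nat_ceiling_divide:
  assumes "s > 0"
  shows "filterlim (\<lambda>h::real. nat \<lceil>s / h\<rceil>) sequentially (at_right 0)"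
  unfolding filterlim_at_top
proof
  fix Z :: nat
  have "eventually (\<lambda>h::real. real Z \<le> s / h) (at_right 0)"
    using filterlim_divide_at_right_0[OF assms] by (simp add: filterlim_at_top)
  then show "eventually (\<lambda>h::real. Z \<le> nat \<lceil>s / h\<rceil>) (at_right 0)"
    by eventually_elim linarith
qed

lemma filterlim_nat_floor_divide:
  assumes "s > 0"
  shows "filterlim (\<lambda>h::real. nat \<lfloor>s / h\<rfloor>) sequentially (at_right 0)"
  unfolding filterlim_at_top
proof
  fix Z :: nat
  have "eventually (\<lambda>h::real. real Z \<le> s / h) (at_right 0)"
    using filterlim_divide_at_right_0[OF assms] by (simp add: filterlim_at_top)
  then show "eventually (\<lambda>h::real. Z \<le> nat \<lfloor>s / h\<rfloor>) (at_right 0)"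
    by eventually_elim linarith
qed

text \<open>The sum is the integral of a step function whose value on \<open>((r - 1) h, r h]\<close> is
  \<open>h powr c * w r * Q h r\<close>; since \<open>c \<le> 0\<close>, sampling at the right end point makes \<open>s powr c\<close> a
  majorant.\<close>

lemma weighted_Riemann_sum:
  fixes w :: "nat \<Rightarrow> real" and Q :: "real \<Rightarrow> nat \<Rightarrow> real"
  assumes w: "(\<lambda>r. w r / real r powr c) \<longlonglongrightarrow> L" and c: "c \<le> 0"
    and a: "0 \<le> a" "a < b" and ac: "a > 0 \<or> c > -1"
    and QB: "\<And>h r. h > 0 \<Longrightarrow> \<bar>Q h r\<bar> \<le> M"
    and Qlim: "\<And>s. a < s \<Longrightarrow> s < b \<Longrightarrow> ((\<lambda>h. Q h (nat \<lceil>s / h\<rceil>)) \<longlongrightarrow> q s) (at_right 0)"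
  shows "((\<lambda>h. h powr (c + 1) * (\<Sum>r\<in>{nat \<lfloor>a / h\<rfloor><..nat \<lfloor>b / h\<rfloor>}. w r * Q h r)) \<longlongrightarrow>
           L * integral {a..b} (\<lambda>s. s powr c * q s)) (at_right 0)"
proof -
  \<comment> \<open>The steps reach at most \<open>h\<close> to the left of \<open>a\<close>. If
    \<open>a > 0\<close>, then \<open>h < a / 2\<close> keeps them right of
    \<open>d = a / 2\<close>, away from the singularity; if \<open>a = 0\<close>, the majorant is
    integrable from \<open>d = 0\<close> because \<open>c > -1\<close>.\<close>
  define \<delta> where "\<delta> = (if a > 0 then a / 2 else 1)"
  define d where "d = (if a > 0 then a / 2 else 0)"
  define R where "R h = {nat \<lfloor>a / h\<rfloor><..nat \<lfloor>b / h\<rfloor>}" for h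
  define S where "S h = h powr (c + 1) * (\<Sum>r\<in>R h. w r * Q h r)" for h
  define F where "F h s = (if nat \<lceil>s / h\<rceil> \<in> R h
    then h powr c * w (nat \<lceil>s / h\<rceil>) * Q h (nat \<lceil>s / h\<rceil>) else 0)" for h s
  define g where "g s = (if a < s \<and> s < b then L * (s powr c * q s) else 0)" for s
  have \<delta>: "\<delta> > 0" by (simp add: \<delta>_def)
  obtain C where C: "\<And>r. \<bar>w r / real r powr c\<bar> \<le> C"
    using convergent_imp_Bseq[OF convergentI[OF w]] unfolding Bseq_def by auto
  have C0: "C \<ge> 0" using C[of 0] by linarith
  have M0: "M \<ge> 0" using QB[of 1 0] by linarith
  have w_le: "\<bar>w r\<bar> \<le> C * real r powr c" if "r > 0" for r
    using C[of r] that by (simp add: abs_divide field_simps)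
  have R_D: "s > 0" "s > a - h" "s \<le> b" "s \<le> real (nat \<lceil>s / h\<rceil>) * h" "nat \<lceil>s / h\<rceil> > 0"
    if h: "h > 0" and r: "nat \<lceil>s / h\<rceil> \<in> R h" for h s
  proof -
    show r0: "nat \<lceil>s / h\<rceil> > 0" using r by (auto simp: R_def)
    then have "s / h > 0" by linarith
    then show "s > 0" using h by (simp add: zero_less_divide_iff)
    have "s / h \<le> real (nat \<lceil>s / h\<rceil>)" by linarith
    then show "s \<le> real (nat \<lceil>s / h\<rceil>) * h" using h by (simp add: field_simps)
    have "0 \<le> a / h" using a h by simp
    moreover have "nat \<lfloor>a / h\<rfloor> < nat \<lceil>s / h\<rceil>" "nat \<lceil>s / h\<rceil> \<le> nat \<lfloor>b / h\<rfloor>"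
      using r by (auto simp: R_def)
    moreover have "0 \<le> b / h" using a h by simp
    ultimately have "s / h > a / h - 1" "s / h \<le> b / h"
      by linarith+
    then have "s / h * h > (a / h - 1) * h" "s / h * h \<le> b / h * h"
      using h by (auto intro!: mult_strict_right_mono mult_right_mono simp del: times_divide_eq_left)
    then show "s > a - h" "s \<le> b" using h by (simp_all add: left_diff_distrib)
  qed
  have F_sum: "F h s = (\<Sum>r\<in>R h. (h powr c * w r * Q h r) * indicat_real {(real r - 1) * h<..real r * h} s)"
    if h: "h > 0" for h s
  proof -
    have "indicat_real {(real r - 1) * h<..real r * h} s = (if r = nat \<lceil>s / h\<rceil> then 1 else 0)"
      if "r \<in> R h" for r
    proof -
      \<comment> \<open>Positivity matters for the equivalence below: \<open>nat\<close> sends every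
        non-positive ceiling to 0.\<close>
      have r: "r > 0" using that by (auto simp: R_def)
      have "s \<in> {(real r - 1) * h<..real r * h} \<longleftrightarrow> real r - 1 < s / h \<and> s / h \<le> real r"
        using h by (auto simp: field_simps)
      also have "\<dots> \<longleftrightarrow> r = nat \<lceil>s / h\<rceil>"
        using r by linarith
      finally show ?thesis by (simp add: indicator_def)
    qed
    then have "(\<Sum>r\<in>R h. (h powr c * w r * Q h r) * indicat_real {(real r - 1) * h<..real r * h} s)
       = (\<Sum>r\<in>R h. if r = nat \<lceil>s / h\<rceil> then h powr c * w r * Q h r else 0)"
      by (intro sum.cong) auto
    also have "\<dots> = F h s"
      unfolding F_def by (subst sum.delta) (auto simp: R_def)
    finally show ?thesis by simp
  qed
  have F_int: "(F h has_integral S h) UNIV" if h: "h > 0" for h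
  proof -
    have "(indicat_real {(real r - 1) * h<..real r * h} has_integral h) UNIV" for r
    proof -
      have "((\<lambda>_. 1::real) has_integral h) {(real r - 1) * h..real r * h}"
        using has_integral_const_real[of "1::real" "(real r - 1) * h" "real r * h"] h
        by (simp add: algebra_simps)
      then have "((\<lambda>s. if s \<in> {(real r - 1) * h..real r * h} then 1 else 0::real) has_integral h) UNIV"
        by (simp only: has_integral_restrict_UNIV)
      then show ?thesis
        by (rule has_integral_spike_finite[where S = "{(real r - 1) * h}", rotated 2])
          (auto simp: indicator_def)
    qed
    then have "((\<lambda>s. \<Sum>r\<in>R h. (h powr c * w r * Q h r) * indicat_real {(real r - 1) * h<..real r * h} s)
      has_integral (\<Sum>r\<in>R h. (h powr c * w r * Q h r) * h)) UNIV"
      by (intro has_integral_sum has_integral_mult_right) (auto simp: R_def)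
    moreover have "(\<Sum>r\<in>R h. (h powr c * w r * Q h r) * h) = S h"
      using h by (simp add: S_def sum_distrib_left powr_add mult_ac)
    moreover have "F h = (\<lambda>s. \<Sum>r\<in>R h. (h powr c * w r * Q h r) * indicat_real {(real r - 1) * h<..real r * h} s)"
      using F_sum[OF h] by (rule ext)
    ultimately show ?thesis
      by simp
  qed
  have F_le: "\<bar>F h s\<bar> \<le> (if s \<in> {d..b} then C * M * s powr c else 0)"
    if h: "h \<in> {0<..<\<delta>}" for h s
  proof (cases "nat \<lceil>s / h\<rceil> \<in> R h")
    case True
    define r where "r = nat \<lceil>s / h\<rceil>"
    have h0: "h > 0" using h by simp
    note D = R_D[OF h0 True, folded r_def]
    have "s \<in> {d..b}"
      using D h by (auto simp: d_def \<delta>_def split: if_splits)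
    have "\<bar>F h s\<bar> = h powr c * \<bar>w r\<bar> * \<bar>Q h r\<bar>"
      using True by (simp add: F_def r_def abs_mult)
    also have "\<dots> \<le> h powr c * (C * real r powr c) * M"
      using w_le[of r] QB[OF h0] D C0 by (intro mult_mono) auto
    also have "\<dots> = C * M * (real r * h) powr c"
      using h0 by (simp add: powr_mult)
    also have "\<dots> \<le> C * M * s powr c"
      using D c C0 M0 by (intro mult_left_mono powr_mono2') auto
    finally show ?thesis using \<open>s \<in> {d..b}\<close> by simp
  qed (use C0 M0 in \<open>simp add: F_def\<close>)
  have bound_int: "(\<lambda>s. if s \<in> {d..b} then C * M * s powr c else 0) integrable_on UNIV"
  proof -
    have "(\<lambda>s. s powr c) integrable_on {d..b}"
    proof (cases "a > 0")
      case True
      then show ?thesis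
        by (intro integrable_continuous_real continuous_intros) (auto simp: d_def)
    next
      case False
      then show ?thesis
        using a ac integrable_on_powr_from_0[of c b] by (auto simp: d_def)
    qed
    then show ?thesis
      by (simp only: integrable_restrict_UNIV) (rule integrable_on_mult_right)
  qed
  have F_lim: "((\<lambda>h. F h s) \<longlongrightarrow> g s) (at_right 0)" if "s \<notin> {a, b}" for s
  proof -
    have pos: "eventually (\<lambda>h::real. h > 0) (at_right 0)"
      by (simp add: eventually_at_right_less)
    have small: "eventually (\<lambda>h::real. h < e) (at_right 0)" if "e > 0" for e
      using that eventually_at_right_real[of 0 e] by (auto elim: eventually_mono)
    consider "s < a" | "s > b" | "a < s" "s < b" using \<open>s \<notin> {a, b}\<close> by force
    then show ?thesis
    proof cases
      case 1
      then have "a - s > 0" by simp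
      from pos small[OF this] have "eventually (\<lambda>h. F h s = g s) (at_right 0)"
        by eventually_elim (use 1 R_D(2) in \<open>force simp: F_def g_def\<close>)
      then show ?thesis by (rule tendsto_eventually)
    next
      case 2
      from pos have "eventually (\<lambda>h. F h s = g s) (at_right 0)"
        by eventually_elim (use 2 R_D(3) in \<open>force simp: F_def g_def\<close>)
      then show ?thesis by (rule tendsto_eventually)
    next
      case 3
      then have s: "s > 0" and bs: "b - s > 0" using a by simp_all
      \<comment> \<open>With \<open>r = nat \<lceil>s / h\<rceil>\<close>, the factor
        \<open>h powr c * w r\<close> equals \<open>w r / real r powr c\<close> times
        \<open>(real r * h) powr c\<close>; here \<open>r\<close> tends to infinity and
        \<open>real r * h\<close> to \<open>s\<close>.\<close>
      have "((\<lambda>h. (w (nat \<lceil>s / h\<rceil>) / real (nat \<lceil>s / h\<rceil>) powr c) *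
          ((real (nat \<lceil>s / h\<rceil>) * h) powr c * Q h (nat \<lceil>s / h\<rceil>))) \<longlongrightarrow> L * (s powr c * q s)) (at_right 0)"
        using s by (intro tendsto_mult tendsto_powr tendsto_const Qlim 3 tendsto_nat_ceiling_mult
          filterlim_compose[OF w filterlim_nat_ceiling_divide]) auto
      moreover have "eventually (\<lambda>h. (w (nat \<lceil>s / h\<rceil>) / real (nat \<lceil>s / h\<rceil>) powr c) *
          ((real (nat \<lceil>s / h\<rceil>) * h) powr c * Q h (nat \<lceil>s / h\<rceil>)) = F h s) (at_right 0)"
        using pos small[OF bs]
      proof eventually_elim
        case (elim h)
        \<comment> \<open>The condition \<open>h < b - s\<close> leaves room for rounding: it puts
          the ceiling of \<open>s / h\<close> at or below the floor of \<open>b / h\<close>.\<close>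
        have "s / h > 0" "a / h < s / h" "s / h < b / h - 1" "0 \<le> a / h"
          using 3 s elim a by (auto simp: field_simps)
        define r where "r = nat \<lceil>s / h\<rceil>"
        have "r \<in> R h" "r > 0"
          using \<open>s / h > 0\<close> \<open>a / h < s / h\<close> \<open>s / h < b / h - 1\<close> \<open>0 \<le> a / h\<close>
          unfolding R_def r_def greaterThanAtMost_iff by linarith+
        then show ?case
          using elim unfolding F_def r_def[symmetric] by (simp add: powr_mult)
      qed
      ultimately show ?thesis
        using 3 by (simp add: g_def tendsto_cong)
    qed
  qed
  have g_int: "integral UNIV g = L * integral {a..b} (\<lambda>s. s powr c * q s)"
  proof -
    have "integral UNIV g = integral UNIV (\<lambda>s. if s \<in> {a<..<b} then L * (s powr c * q s) else 0)"
      by (rule integral_cong) (auto simp: g_def)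
    also have "\<dots> = integral {a<..<b} (\<lambda>s. L * (s powr c * q s))"
      by (rule integral_restrict_UNIV)
    also have "\<dots> = L * integral {a..b} (\<lambda>s. s powr c * q s)"
      by (simp add: integral_open_interval_real)
    finally show ?thesis .
  qed
  \<comment> \<open>Dominated convergence is a statement about sequences, so the limit is tested
    along arbitrary sequences in \<open>{0<..<\<delta>}\<close>.\<close>
  have "(S \<longlongrightarrow> integral UNIV g) (at 0 within {0<..<\<delta>})"
    unfolding tendsto_at_iff_sequentially
  proof (intro allI impI)
    fix X assume X: "\<forall>i. X i \<in> {0<..<\<delta>} - {0}" "X \<longlonglongrightarrow> 0"
    \<comment> \<open>Pointwise convergence is known only off the two end points; redefining the
      step functions there leaves the integrals unchanged.\<close>
    define G where "G k s = (if s \<in> {a, b} then 0 else F (X k) s)" for k s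
    have X_right: "filterlim X (at_right 0) sequentially"
      using X by (intro tendsto_imp_filterlim_at_right) auto
    have G_int: "(G k has_integral S (X k)) UNIV" for k
      by (rule has_integral_spike_finite[where S = "{a, b}", OF _ _ F_int[of "X k"]])
        (use X in \<open>auto simp: G_def\<close>)
    have "(\<lambda>k. integral UNIV (G k)) \<longlonglongrightarrow> integral UNIV g"
    proof (rule dominated_convergence(2))
      show "G k integrable_on UNIV" for k
        using G_int by (rule has_integral_integrable)
      show "norm (G k s) \<le> (if s \<in> {d..b} then C * M * s powr c else 0)" for k s
        using F_le[of "X k" s] X(1) C0 M0 by (auto simp: G_def)
      show "(\<lambda>k. G k s) \<longlonglongrightarrow> g s" for s
      proof (cases "s \<in> {a, b}")
        case False
        then show ?thesis
          using filterlim_compose[OF F_lim X_right] by (simp add: G_def)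
      qed (auto simp: G_def g_def)
    qed (rule bound_int)
    then show "(S \<circ> X) \<longlonglongrightarrow> integral UNIV g"
      using integral_unique[OF G_int] by (simp add: o_def)
  qed
  moreover have "at 0 within {0<..<\<delta>} = at_right 0"
    using \<delta> by (intro at_within_nhd[of _ "{..<\<delta>}"]) auto
  ultimately show ?thesis
    unfolding g_int S_def R_def by simp
qed

subsection \<open>The Grunwald-Letnikov derivative\<close>

definition backward_diff :: "real \<Rightarrow> (real \<Rightarrow> real) \<Rightarrow> real \<Rightarrow> real" where
  "backward_diff h f = (\<lambda>y. f y - f (y - h))"

text \<open>The differences \<open>backward_diff h (P j)\<close> again form a sequence of successive
  derivatives; the induction hypothesis for them leaves one difference, to which the mean value
  theorem applies.\<close>

lemma backward_diff_mean_value: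
  fixes P :: "nat \<Rightarrow> real \<Rightarrow> real"
  assumes "\<And>j t. j < k \<Longrightarrow> (P j has_real_derivative P (Suc j) t) (at t)" and h: "h > 0"
  shows "\<exists>\<xi>. y - real k * h \<le> \<xi> \<and> \<xi> \<le> y \<and> (backward_diff h ^^ k) (P 0) y = h ^ k * P k \<xi>"
  using assms(1)
proof (induction k arbitrary: P)
  case (Suc k)
  have "(backward_diff h (P j) has_real_derivative backward_diff h (P (Suc j)) t) (at t)"
    if "j < k" for j t
    unfolding backward_diff_def
    using that by (auto intro!: derivative_eq_intros DERIV_chain2[OF Suc.prems])
  from Suc.IH[of "\<lambda>j. backward_diff h (P j)", OF this] obtain \<xi> where \<xi>: "y - real k * h \<le> \<xi>" "\<xi> \<le> y"
    "(backward_diff h ^^ k) (backward_diff h (P 0)) y = h ^ k * backward_diff h (P k) \<xi>"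
    by blast
  obtain \<zeta> where \<zeta>: "\<zeta> > \<xi> - h" "\<zeta> < \<xi>" "P k \<xi> - P k (\<xi> - h) = (\<xi> - (\<xi> - h)) * P (Suc k) \<zeta>"
    using MVT2[of "\<xi> - h" \<xi> "P k" "P (Suc k)"] Suc.prems[of k] h by auto
  show ?case
  proof (intro exI conjI)
    show "y - real (Suc k) * h \<le> \<zeta>" "\<zeta> \<le> y"
      using \<xi> \<zeta> by (simp_all add: algebra_simps)
    show "(backward_diff h ^^ Suc k) (P 0) y = h ^ Suc k * P (Suc k) \<zeta>"
      using \<xi>(3) \<zeta>(3) backward_diff_def[of h "P k"] by (simp add: funpow_swap1)
  qed
qed auto

text \<open>The base point moves with \<open>h\<close> because it will be a grid point such as
  \<open>t - real (nat \<lceil>s / h\<rceil>) * h\<close>; the intermediate point is squeezed to the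
  same limit.\<close>

lemma tendsto_backward_diff_quotient:
  fixes P :: "nat \<Rightarrow> real \<Rightarrow> real"
  assumes D: "\<And>j t. j < k \<Longrightarrow> (P j has_real_derivative P (Suc j) t) (at t)"
    and cont: "isCont (P k) y\<^sub>0" and y: "(y \<longlongrightarrow> y\<^sub>0) (at_right 0)"
  shows "((\<lambda>h. (backward_diff h ^^ k) (P 0) (y h) / h ^ k) \<longlongrightarrow> P k y\<^sub>0) (at_right 0)"
proof -
  have pos: "eventually (\<lambda>h::real. h > 0) (at_right 0)"
    by (simp add: eventually_at_right_less)
  have "\<forall>h. \<exists>z. h > 0 \<longrightarrow> y h - real k * h \<le> z \<and> z \<le> y h \<and>
      (backward_diff h ^^ k) (P 0) (y h) = h ^ k * P k z"
    using backward_diff_mean_value[of k P, OF D] by blast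
  then obtain z where z: "\<And>h. h > 0 \<Longrightarrow> y h - real k * h \<le> z h" "\<And>h. h > 0 \<Longrightarrow> z h \<le> y h"
    "\<And>h. h > 0 \<Longrightarrow> (backward_diff h ^^ k) (P 0) (y h) = h ^ k * P k (z h)"
    by metis
  have "(z \<longlongrightarrow> y\<^sub>0) (at_right 0)"
  proof (rule tendsto_sandwich)
    show "eventually (\<lambda>h. y h - real k * h \<le> z h) (at_right 0)" "eventually (\<lambda>h. z h \<le> y h) (at_right 0)"
      using pos by (eventually_elim; use z in auto)+
    have "((\<lambda>h. y h - real k * h) \<longlongrightarrow> y\<^sub>0 - real k * 0) (at_right 0)"
      by (intro tendsto_intros y)
    then show "((\<lambda>h. y h - real k * h) \<longlongrightarrow> y\<^sub>0) (at_right 0)" by simp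
  qed (rule y)
  then have "((\<lambda>h. P k (z h)) \<longlongrightarrow> P k y\<^sub>0) (at_right 0)"
    by (rule isCont_tendsto_compose[OF cont])
  moreover have "eventually (\<lambda>h. P k (z h) = (backward_diff h ^^ k) (P 0) (y h) / h ^ k) (at_right 0)"
    using pos by eventually_elim (simp add: z(3))
  ultimately show ?thesis
    by (rule Lim_transform_eventually)
qed

section \<open>Binomial weights and summation by parts\<close>

definition signed_gbinomial :: "real \<Rightarrow> nat \<Rightarrow> real" where
  "signed_gbinomial a r = (- 1) ^ r * (a gchoose r)"

text \<open>The weights are the power series coefficients of \<open>(1 - z) powr a\<close>; this
  compares coefficients after splitting off one factor \<open>1 - z\<close>.\<close>

lemma signed_gbinomial_Suc:
  "signed_gbinomial a (Suc r) = signed_gbinomial (a - 1) (Suc r) - signed_gbinomial (a - 1) r"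
  unfolding signed_gbinomial_def gbinomial_addition_formula[of a r] by (simp add: algebra_simps)

text \<open>Supplies \<open>weighted_Riemann_sum\<close> with \<open>c = - a - 1\<close>: the order
  \<open>a = \<alpha>\<close> gives the kernel of the increment, and \<open>a = \<alpha> - n\<close>
  an integrable kernel.\<close>

lemma signed_gbinomial_asymptotic:
  "(\<lambda>r. signed_gbinomial a r / real r powr (- a - 1)) \<longlonglongrightarrow> inverse (Gamma (- a))"
proof (rule Lim_transform_eventually[OF gbinomial_asymptotic[of a]])
  show "eventually (\<lambda>r. (a gchoose r) / ((- 1) ^ r / exp ((a + 1) * of_real (ln (real r)))) =
      signed_gbinomial a r / real r powr (- a - 1)) sequentially"
    using eventually_gt_at_top[of 0]
  proof eventually_elim
    case (elim r)
    define X where "X = exp ((a + 1) * ln (real r))"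
    have "real r powr (- a - 1) = inverse X"
      using elim by (simp add: X_def powr_def exp_minus[symmetric] algebra_simps)
    then show ?case
      by (cases "even r") (simp_all add: signed_gbinomial_def X_def[symmetric] divide_inverse)
  qed
qed

lemma signed_gbinomial_sum_by_parts:
  fixes f :: "nat \<Rightarrow> real"
  shows "(\<Sum>r\<le>N. signed_gbinomial a r * f r) =
    (\<Sum>r\<le>N. signed_gbinomial (a - 1) r * (f r - f (Suc r))) + signed_gbinomial (a - 1) N * f (Suc N)"
proof (induction N)
  case 0
  show ?case by (simp add: signed_gbinomial_def)
next
  case (Suc N)
  then show ?case by (simp add: signed_gbinomial_Suc[of a] algebra_simps)
qed

text \<open>Each summation by parts lowers the order of the weights by one, differences
  \<open>p\<close> once more and leaves one boundary term. For \<open>N\<close> the floor of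
  \<open>t / h\<close>, that term starts at a grid point left of 0, where the extension is
  needed.\<close>

lemma signed_gbinomial_sum_by_parts_iterated:
  "(\<Sum>r\<le>N. signed_gbinomial a r * p (t - real r * h)) =
    (\<Sum>r\<le>N. signed_gbinomial (a - real k) r * (backward_diff h ^^ k) p (t - real r * h)) +
    (\<Sum>j<k. signed_gbinomial (a - real j - 1) N * (backward_diff h ^^ j) p (t - real (Suc N) * h))"
proof (induction k)
  case (Suc k)
  have "(\<Sum>r\<le>N. signed_gbinomial (a - real k) r * (backward_diff h ^^ k) p (t - real r * h)) =
    (\<Sum>r\<le>N. signed_gbinomial (a - real (Suc k)) r * (backward_diff h ^^ Suc k) p (t - real r * h)) +
    signed_gbinomial (a - real k - 1) N * (backward_diff h ^^ k) p (t - real (Suc N) * h)"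
    unfolding signed_gbinomial_sum_by_parts[of "a - real k"]
    by (simp add: backward_diff_def algebra_simps)
  with Suc show ?case by simp
qed simp

text \<open>The powers of \<open>h\<close> balance: the weight behaves like
  \<open>N powr (j - \<alpha>)\<close> and the difference like \<open>h ^ j * P j 0\<close>, so the
  product is governed by \<open>(N * h) powr (j - \<alpha>)\<close>, where \<open>N * h\<close>
  tends to \<open>t\<close>.\<close>

lemma GL_boundary_term_converges:
  fixes P :: "nat \<Rightarrow> real \<Rightarrow> real"
  assumes D: "\<And>i s. i < j \<Longrightarrow> (P i has_real_derivative P (Suc i) s) (at s)"
    and cont: "isCont (P j) 0" and t: "t > 0"
  shows "\<exists>l. ((\<lambda>h. h powr (- \<alpha>) * (signed_gbinomial (\<alpha> - real j - 1) (nat \<lfloor>t / h\<rfloor>) *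
    (backward_diff h ^^ j) (P 0) (t - real (Suc (nat \<lfloor>t / h\<rfloor>)) * h))) \<longlongrightarrow> l) (at_right 0)"
proof -
  define N where "N h = nat \<lfloor>t / h\<rfloor>" for h
  define c where "c = - (\<alpha> - real j - 1) - 1"
  have "((\<lambda>h. t - real (N h) * h - h) \<longlongrightarrow> t - t - 0) (at_right 0)"
    unfolding N_def by (intro tendsto_intros tendsto_nat_floor_mult t)
  then have "((\<lambda>h. t - real (Suc (N h)) * h) \<longlongrightarrow> 0) (at_right 0)"
    by (simp add: algebra_simps)
  note B = tendsto_backward_diff_quotient[of j P, OF D cont this]
  have "filterlim N sequentially (at_right 0)"
    unfolding N_def by (rule filterlim_nat_floor_divide[OF t])
  note W = filterlim_compose[OF signed_gbinomial_asymptotic this]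
  have "((\<lambda>h. (signed_gbinomial (\<alpha> - real j - 1) (N h) / real (N h) powr c) *
      ((real (N h) * h) powr c *
      ((backward_diff h ^^ j) (P 0) (t - real (Suc (N h)) * h) / h ^ j)))
    \<longlongrightarrow> inverse (Gamma (- (\<alpha> - real j - 1))) * (t powr c * P j 0)) (at_right 0)"
    unfolding c_def using t
    by (intro tendsto_mult tendsto_powr tendsto_const W B) (auto simp: N_def intro: tendsto_nat_floor_mult)
  moreover have "eventually (\<lambda>h. (signed_gbinomial (\<alpha> - real j - 1) (N h) / real (N h) powr c) *
      ((real (N h) * h) powr c *
      ((backward_diff h ^^ j) (P 0) (t - real (Suc (N h)) * h) / h ^ j)) =
      h powr (- \<alpha>) * (signed_gbinomial (\<alpha> - real j - 1) (N h) *
        (backward_diff h ^^ j) (P 0) (t - real (Suc (N h)) * h))) (at_right 0)"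
    using eventually_at_right_real[OF t]
  proof eventually_elim
    case (elim h)
    \<comment> \<open>\<open>h < t\<close> makes \<open>N h\<close> positive, so that
      \<open>real (N h) powr c\<close> can be cancelled.\<close>
    then have "t / h \<ge> 1" by (simp add: field_simps)
    then have N: "N h > 0" unfolding N_def by linarith
    have "h powr c = h powr (- \<alpha>) * h ^ j"
      using elim unfolding c_def by (simp add: powr_realpow[symmetric] powr_add[symmetric])
    then show ?case
      using elim N by (simp add: powr_mult)
  qed
  ultimately show ?thesis
    unfolding N_def by (blast intro: Lim_transform_eventually)
qed

text \<open>After \<open>n\<close> summations by parts the weights have order
  \<open>- \<beta>\<close> in \<open>(-1, 0)\<close>, so the kernel
  \<open>s powr (\<beta> - 1)\<close> is integrable at 0 and \<open>weighted_Riemann_sum\<close>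
  applies from \<open>a = 0\<close>. The boundary terms converge one by one.\<close>

lemma GL_sum_converges:
  fixes P :: "nat \<Rightarrow> real \<Rightarrow> real"
  assumes \<alpha>: "real n - 1 < \<alpha>" "\<alpha> < real n"
    and D: "\<And>k s. k < n \<Longrightarrow> (P k has_real_derivative P (Suc k) s) (at s)"
    and cont: "continuous_on UNIV (P n)" and bound: "\<And>s. \<bar>P n s\<bar> \<le> M" and t: "t > 0"
  shows "\<exists>l. ((\<lambda>h. h powr (- \<alpha>) * (\<Sum>r\<le>nat \<lfloor>t / h\<rfloor>. signed_gbinomial \<alpha> r * P 0 (t - real r * h)))
    \<longlongrightarrow> l) (at_right 0)"
proof -
  define N where "N h = nat \<lfloor>t / h\<rfloor>" for h
  define \<beta> where "\<beta> = real n - \<alpha>"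
  define Q where "Q h r = (backward_diff h ^^ n) (P 0) (t - real r * h) / h ^ n" for h and r :: nat
  have \<beta>: "0 < \<beta>" "\<beta> < 1" using \<alpha> by (auto simp: \<beta>_def)
  have P_cont: "isCont (P k) s" if "k \<le> n" for k s
    using that cont D[of k s] DERIV_isCont by (cases "k = n") (auto simp: continuous_on_eq_continuous_at)
  have Q_le: "\<bar>Q h r\<bar> \<le> M" if h: "h > 0" for h r
  proof -
    obtain \<xi> where "(backward_diff h ^^ n) (P 0) (t - real r * h) = h ^ n * P n \<xi>"
      using backward_diff_mean_value[of n P, OF D h] by blast
    then show ?thesis using bound[of \<xi>] h by (simp add: Q_def)
  qed
  have Q_lim: "((\<lambda>h. Q h (nat \<lceil>s / h\<rceil>)) \<longlongrightarrow> P n (t - s)) (at_right 0)" if "s > 0" for s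
    unfolding Q_def
    by (intro tendsto_backward_diff_quotient D P_cont tendsto_diff tendsto_const tendsto_nat_ceiling_mult that) auto
  have "((\<lambda>h. h powr (\<beta> - 1 + 1) * (\<Sum>r\<in>{nat \<lfloor>0 / h\<rfloor><..nat \<lfloor>t / h\<rfloor>}. signed_gbinomial (- \<beta>) r * Q h r)) \<longlongrightarrow>
    inverse (Gamma \<beta>) * integral {0..t} (\<lambda>s. s powr (\<beta> - 1) * P n (t - s))) (at_right 0)"
    using signed_gbinomial_asymptotic[of "- \<beta>"] \<beta> t Q_le Q_lim
    by (intro weighted_Riemann_sum) auto
  \<comment> \<open>The Riemann sum starts at index 1; the term of index 0, with weight 1, is
    treated separately and disappears.\<close>
  moreover have "((\<lambda>h. h powr \<beta> * Q h 0) \<longlongrightarrow> 0) (at_right 0)"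
  proof -
    have "((\<lambda>h. Q h 0) \<longlongrightarrow> P n t) (at_right 0)"
      unfolding Q_def using tendsto_backward_diff_quotient[of n P t "\<lambda>_. t", OF D] P_cont by simp
    moreover have "((\<lambda>h. h powr \<beta>) \<longlongrightarrow> 0) (at_right 0)"
      using \<beta> by (intro tendsto_zero_powrI[where b = \<beta>] tendsto_intros)
        (auto intro: eventually_mono[OF eventually_at_right_less])
    ultimately show ?thesis using tendsto_mult by force
  qed
  ultimately have main: "((\<lambda>h. h powr \<beta> * Q h 0 +
      h powr \<beta> * (\<Sum>r\<in>{0<..N h}. signed_gbinomial (- \<beta>) r * Q h r)) \<longlongrightarrow>
    0 + inverse (Gamma \<beta>) * integral {0..t} (\<lambda>s. s powr (\<beta> - 1) * P n (t - s))) (at_right 0)"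
    unfolding N_def by (intro tendsto_add) simp_all
  define b where "b j h = h powr (- \<alpha>) * (signed_gbinomial (\<alpha> - real j - 1) (N h) *
    (backward_diff h ^^ j) (P 0) (t - real (Suc (N h)) * h))" for j h
  have "\<exists>l. (b j \<longlongrightarrow> l) (at_right 0)" if "j < n" for j
    unfolding b_def N_def using that D P_cont t by (intro GL_boundary_term_converges) auto
  then obtain l where "\<And>j. j < n \<Longrightarrow> (b j \<longlongrightarrow> l j) (at_right 0)"
    by metis
  then have "((\<lambda>h. \<Sum>j<n. b j h) \<longlongrightarrow> (\<Sum>j<n. l j)) (at_right 0)"
    by (intro tendsto_sum) auto
  note lim = tendsto_add[OF main this]
  have "eventually (\<lambda>h. h powr \<beta> * Q h 0 +
      h powr \<beta> * (\<Sum>r\<in>{0<..N h}. signed_gbinomial (- \<beta>) r * Q h r) + (\<Sum>j<n. b j h) =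
      h powr (- \<alpha>) * (\<Sum>r\<le>N h. signed_gbinomial \<alpha> r * P 0 (t - real r * h))) (at_right 0)"
    using eventually_at_right_less[of "0::real"]
  proof eventually_elim
    case (elim h)
    have "{..N h} = insert 0 {0<..N h}" by auto
    then have "h powr \<beta> * Q h 0 + h powr \<beta> * (\<Sum>r\<in>{0<..N h}. signed_gbinomial (- \<beta>) r * Q h r) =
        h powr \<beta> * (\<Sum>r\<le>N h. signed_gbinomial (- \<beta>) r * Q h r)"
      by (simp add: signed_gbinomial_def distrib_left)
    also have "h powr \<beta> = h powr (- \<alpha>) * h ^ n"
      using elim by (simp add: \<beta>_def powr_realpow[symmetric] powr_add[symmetric])
    then have "h powr \<beta> * (\<Sum>r\<le>N h. signed_gbinomial (- \<beta>) r * Q h r) =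
       h powr (- \<alpha>) * (\<Sum>r\<le>N h. signed_gbinomial (\<alpha> - real n) r * (backward_diff h ^^ n) (P 0) (t - real r * h))"
      using elim by (simp add: Q_def \<beta>_def sum_distrib_left mult_ac)
    finally show ?case
      unfolding signed_gbinomial_sum_by_parts_iterated[of \<alpha> "P 0" t h "N h" n]
      by (simp add: b_def sum_distrib_left distrib_left)
  qed
  with lim show ?thesis
    unfolding N_def by (blast intro: Lim_transform_eventually)
qed

text \<open>By periodicity the sum for \<open>t\<close> cancels inside the one for
  \<open>t + T\<close>. The remaining indices satisfy \<open>r * h > t\<close>, so
  \<open>weighted_Riemann_sum\<close> applies with \<open>a = t > 0\<close> although the exponent is
  below -1.\<close>

lemma GL_sum_shift:
  fixes p :: "real \<Rightarrow> real"
  assumes \<alpha>: "\<alpha> > 0" and t: "t > 0" and T: "T > 0" and per: "\<And>s. p (s + T) = p s"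
    and p: "continuous_on UNIV p" and bound: "\<And>s. \<bar>p s\<bar> \<le> M"
  defines "S \<equiv> \<lambda>t h. h powr (- \<alpha>) * (\<Sum>r\<le>nat \<lfloor>t / h\<rfloor>. signed_gbinomial \<alpha> r * p (t - real r * h))"
  shows "((\<lambda>h. S (t + T) h - S t h) \<longlongrightarrow>
    inverse (Gamma (- \<alpha>)) * power_moment T (\<lambda>u. p (- u)) (- \<alpha> - 1) t) (at_right 0)"
proof -
  have "isCont p s" for s
    using p by (simp add: continuous_on_eq_continuous_at)
  then have "((\<lambda>h. h powr (- \<alpha> - 1 + 1) * (\<Sum>r\<in>{nat \<lfloor>t / h\<rfloor><..nat \<lfloor>(t + T) / h\<rfloor>}.
      signed_gbinomial \<alpha> r * p (t - real r * h))) \<longlongrightarrow>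
    inverse (Gamma (- \<alpha>)) * integral {t..t + T} (\<lambda>s. s powr (- \<alpha> - 1) * p (t - s))) (at_right 0)"
    using signed_gbinomial_asymptotic[of \<alpha>] \<alpha> t T bound
    by (intro weighted_Riemann_sum isCont_tendsto_compose[where g = p]
        tendsto_diff tendsto_const tendsto_nat_ceiling_mult) auto
  moreover have "eventually (\<lambda>h. h powr (- \<alpha> - 1 + 1) * (\<Sum>r\<in>{nat \<lfloor>t / h\<rfloor><..nat \<lfloor>(t + T) / h\<rfloor>}.
      signed_gbinomial \<alpha> r * p (t - real r * h)) = S (t + T) h - S t h) (at_right 0)"
    using eventually_at_right_less[of "0::real"]
  proof eventually_elim
    case (elim h)
    have "t / h \<le> (t + T) / h" using elim T by (simp add: divide_right_mono)
    then have "nat \<lfloor>t / h\<rfloor> \<le> nat \<lfloor>(t + T) / h\<rfloor>" by linarith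
    then have "{..nat \<lfloor>(t + T) / h\<rfloor>} = {..nat \<lfloor>t / h\<rfloor>} \<union> {nat \<lfloor>t / h\<rfloor><..nat \<lfloor>(t + T) / h\<rfloor>}"
      by auto
    then have "(\<Sum>r\<le>nat \<lfloor>(t + T) / h\<rfloor>. signed_gbinomial \<alpha> r * p (t - real r * h)) =
      (\<Sum>r\<le>nat \<lfloor>t / h\<rfloor>. signed_gbinomial \<alpha> r * p (t - real r * h)) +
      (\<Sum>r\<in>{nat \<lfloor>t / h\<rfloor><..nat \<lfloor>(t + T) / h\<rfloor>}. signed_gbinomial \<alpha> r * p (t - real r * h))"
      by (simp add: sum.union_disjoint disjoint_iff)
    moreover have "p (t + T - real r * h) = p (t - real r * h)" for r
      using per[of "t - real r * h"] by (simp add: algebra_simps)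
    ultimately show ?case by (simp add: S_def algebra_simps)
  qed
  moreover have "integral {t..t + T} (\<lambda>s. s powr (- \<alpha> - 1) * p (t - s)) =
      power_moment T (\<lambda>u. p (- u)) (- \<alpha> - 1) t"
    using integral_shift_real_ivl[of t t "t + T" "\<lambda>s. s powr (- \<alpha> - 1) * p (t - s)"]
    by (simp add: power_moment_def add.commute)
  ultimately show ?thesis by (simp add: tendsto_cong)
qed

text \<open>As both limits exist, the increment of the sums tends to the difference of the
  derivatives, which periodicity makes 0; \<open>GL_sum_shift\<close> evaluates the same
  limit.\<close>

lemma GL_deriv_periodic_imp:
  fixes P :: "nat \<Rightarrow> real \<Rightarrow> real"
  assumes \<alpha>: "\<alpha> > 0" "\<alpha> \<notin> \<nat>" and n: "real n - 1 < \<alpha>" "\<alpha> < real n" and T: "T > 0"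
    and D: "\<And>k t. k < n \<Longrightarrow> (P k has_real_derivative P (Suc k) t) (at t)"
    and cont: "continuous_on UNIV (P n)"
    and per: "\<And>t. P 0 (t + T) = P 0 t"
    and bound: "\<And>s. \<bar>P 0 s\<bar> \<le> M" "\<And>s. \<bar>P n s\<bar> \<le> M'"
    and g: "\<And>t. t \<ge> 0 \<Longrightarrow> g t = P 0 t"
    and GL: "periodic_on_pos T (GL_deriv \<alpha> g)" and t: "t > 0"
  shows "power_moment T (\<lambda>u. P 0 (- u)) (- \<alpha> - 1) t = 0"
proof -
  define S where "S t h = h powr (- \<alpha>) * (\<Sum>r\<le>nat \<lfloor>t / h\<rfloor>. signed_gbinomial \<alpha> r * P 0 (t - real r * h))" for t h
  have S_lim: "(S t \<longlongrightarrow> GL_deriv \<alpha> g t) (at_right 0)" if t: "t > 0" for t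
  proof -
    obtain l where l: "(S t \<longlongrightarrow> l) (at_right 0)"
      unfolding S_def using GL_sum_converges[OF n D cont bound(2) t] by blast
    have "eventually (\<lambda>h. S t h = h powr (- \<alpha>) * (\<Sum>r = 0..nat \<lfloor>t / h\<rfloor>. (- 1) ^ r * (\<alpha> gchoose r) * g (t - real r * h))) (at_right 0)"
      using eventually_at_right_less[of "0::real"]
    proof eventually_elim
      case (elim h)
      \<comment> \<open>The grid points used are non-negative and may include 0, so agreement of
        \<open>g\<close> and \<open>P 0\<close> at 0 matters.\<close>
      have "g (t - real r * h) = P 0 (t - real r * h)" if "r \<le> nat \<lfloor>t / h\<rfloor>" for r
      proof -
        have "t / h \<ge> 0" using t elim by simp
        with that have "real r \<le> t / h" by linarith
        then show ?thesis using elim by (intro g) (simp add: field_simps)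
      qed
      then show ?case
        unfolding S_def signed_gbinomial_def by (simp add: atMost_atLeast0)
    qed
    from Lim_transform_eventually[OF l this] have "GL_deriv \<alpha> g t = l"
      unfolding GL_deriv_def by (intro tendsto_Lim) auto
    with l show ?thesis by simp
  qed
  have P0: "continuous_on UNIV (P 0)"
    using D[of 0] cont by (cases "n = 0") (auto intro: DERIV_continuous_on)
  have "((\<lambda>h. S (t + T) h - S t h) \<longlongrightarrow> GL_deriv \<alpha> g (t + T) - GL_deriv \<alpha> g t) (at_right 0)"
    using t T by (intro tendsto_diff S_lim) auto
  then have diff_0: "((\<lambda>h. S (t + T) h - S t h) \<longlongrightarrow> 0) (at_right 0)"
    using GL t by (simp add: periodic_on_pos_def)
  have "inverse (Gamma (- \<alpha>)) * power_moment T (\<lambda>u. P 0 (- u)) (- \<alpha> - 1) t = 0"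
    using GL_sum_shift[OF \<alpha>(1) t T per P0 bound(1), folded S_def]
    by (rule tendsto_unique[OF trivial_limit_at_right_real _ diff_0])
  \<comment> \<open>Non-integrality of \<open>\<alpha>\<close> enters here: \<open>Gamma\<close> has
    no pole at \<open>- \<alpha>\<close>, so its reciprocal does not vanish.\<close>
  moreover have "- \<alpha> \<notin> \<int>\<^sub>\<le>\<^sub>0"
    using \<alpha>(2) by (auto elim!: nonpos_Ints_cases' simp: Nats_def)
  then have "Gamma (- \<alpha>) \<noteq> 0"
    by (simp add: Gamma_eq_zero_iff)
  ultimately show ?thesis by simp
qed

subsection \<open>Non-periodicity\<close>

text \<open>The reflected form \<open>p (- u)\<close> matches the function that appears in the power
  moments.\<close>

lemma periodic_representative:
  fixes p :: "real \<Rightarrow> real"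
  assumes T: "T > 0" and per: "\<And>s. p (s + T) = p s"
  obtains u where "u \<in> {0..T}" "p s = p (- u)"
proof
  define k where "k = \<lceil>s / T\<rceil>"
  have "of_int k - 1 < s / T" "s / T \<le> of_int k"
    unfolding k_def by linarith+
  then show "of_int k * T - s \<in> {0..T}"
    using T by (auto simp: field_simps)
  have shift: "p (s + real m * T) = p s" for s m
  proof (induction m)
    case (Suc m)
    then show ?case using per[of "s + real m * T"] by (simp add: algebra_simps)
  qed simp
  show "p s = p (- (of_int k * T - s))"
  proof (cases "k \<ge> 0")
    case True
    then show ?thesis using shift[of "s - of_int k * T" "nat k"] by simp
  next
    case False
    then show ?thesis using shift[of s "nat (- k)"] by simp
  qed
qed

lemma periodic_continuous_bounded:
  fixes p :: "real \<Rightarrow> real"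
  assumes T: "T > 0" and per: "\<And>s. p (s + T) = p s" and cont: "continuous_on UNIV p"
  obtains M where "\<And>s. \<bar>p s\<bar> \<le> M"
proof -
  have "continuous_on {0..T} (\<lambda>u. p (- u))"
    by (intro continuous_on_compose2[OF cont] continuous_intros) auto
  then have "bounded ((\<lambda>u. p (- u)) ` {0..T})"
    by (intro compact_imp_bounded compact_continuous_image) auto
  then obtain M where M: "\<And>u. u \<in> {0..T} \<Longrightarrow> \<bar>p (- u)\<bar> \<le> M"
    unfolding bounded_iff real_norm_def by (metis imageI)
  show thesis
  proof (rule that)
    fix s
    obtain u where "u \<in> {0..T}" "p s = p (- u)"
      using periodic_representative[of T p] T per by blast
    then show "\<bar>p s\<bar> \<le> M" using M by simp
  qed
qed

theorem corollary1:
  fixes \<alpha> T :: real and n :: nat and x :: "real \<Rightarrow> real"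
  assumes "\<alpha> > 0" and "\<alpha> \<notin> \<nat>"
    and "n = nat \<lfloor>\<alpha>\<rfloor> + 1"
    and "T > 0"
    and "class_C_on n {0<..} x"
    and "periodic_on_pos T x"
    and "\<not> x constant_on {0<..}"
  shows "\<not> periodic_on_pos T (RL_deriv \<alpha> (extend_at_0 T x)) \<and>
         \<not> periodic_on_pos T (GL_deriv \<alpha> (extend_at_0 T x))"
proof -
  obtain P where P_x: "\<And>t. t > 0 \<Longrightarrow> P 0 t = x t"
    and D: "\<And>k t. k < n \<Longrightarrow> (P k has_real_derivative P (Suc k) t) (at t)"
    and cont: "continuous_on UNIV (P n)"
    and per: "\<And>k t. P k (t + T) = P k t"
    using periodic_extension[OF assms(4,5,6)] by blast
  have n: "real n - 1 < \<alpha>" "\<alpha> < real n"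
  proof -
    have "\<alpha> \<noteq> real (nat \<lfloor>\<alpha>\<rfloor>)"
      using assms(2) by (metis of_nat_in_Nats)
    then show "real n - 1 < \<alpha>" "\<alpha> < real n"
      using assms(1) unfolding assms(3) by linarith+
  qed
  have P0: "continuous_on UNIV (P 0)"
    using D[of 0] assms(3) by (auto intro: DERIV_continuous_on)
  \<comment> \<open>At 0 the prescribed value \<open>x T\<close> equals \<open>P 0 T = P 0 0\<close>
    by periodicity.\<close>
  have g: "extend_at_0 T x t = P 0 t" if "t \<ge> 0" for t
    using that P_x[of t] P_x[of T] per[of 0 0] assms(4) by (auto simp: extend_at_0_def)
  obtain M M' where bound: "\<And>s. \<bar>P 0 s\<bar> \<le> M" "\<And>s. \<bar>P n s\<bar> \<le> M'"
    using periodic_continuous_bounded[OF assms(4) per P0]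
      periodic_continuous_bounded[OF assms(4) per cont] by metis
  \<comment> \<open>If all moments vanished, \<open>P 0\<close> would be zero on a full period,
    hence \<open>x\<close> zero on the half-line and so constant.\<close>
  have nonzero: "\<not> (\<forall>t>0. power_moment T (\<lambda>u. P 0 (- u)) (- \<alpha> - 1) t = 0)"
  proof
    assume zero: "\<forall>t>0. power_moment T (\<lambda>u. P 0 (- u)) (- \<alpha> - 1) t = 0"
    have "continuous_on {0..T} (\<lambda>u. P 0 (- u))"
      by (intro continuous_on_compose2[OF P0] continuous_intros) auto
    then have vanish: "P 0 (- u) = 0" if "u \<in> {0..T}" for u
      by (rule power_moment_vanishing[where c = "- \<alpha> - 1"]) (use zero assms(1,4) that in auto)
    have "x t = 0" if "t > 0" for t
      using periodic_representative[of T "P 0" t, OF assms(4) per] vanish P_x[OF that] by metis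
    then show False
      using assms(7) unfolding constant_on_def by auto
  qed
  show ?thesis
    using RL_deriv_periodic_imp[OF assms(3) n assms(4) D cont per g]
      GL_deriv_periodic_imp[OF assms(1,2) n assms(4) D cont per bound g] nonzero
    by blast
qed

end
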